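(* Let $5 \le p \le q$ and let $D$ be a strong orientation of $K(3,p,q)$ with diameter two, with parts $V_1=\{x_1,x_2,x_3\}$, $V_2$ ($|V_2|=p$), $V_3$ ($|V_3|=q$). If exactly two of the eight sets $V_2^A$ ($A \subseteq \{1,2,3\}$) are nonempty, then $q \le \binom{p+1}{\lfloor \frac{p+1}{2} \rfloor} - 1$.
   Context: $K(3,p,q)$ is the complete tripartite graph with parts $V_1=\{x_1,x_2,x_3\}$, $V_2$ of size $p$, $V_3$ of size $q$. A strong orientation is an orientation of all edges making the digraph strongly connected; its diameter is the maximum directed distance between ordered pairs of vertices. Write $u\to v$ if the edge $uv$ is oriented from $u$ to $v$. For $A \subseteq [3]=\{1,2,3\}$, let $N_D^A$ be the set of vertices $w$ such that $x_i \to w$ for all $i \in A$ and $w \to x_j$ for all $j \in [3]\setminus A$, and $V_2^A = V_2 \cap N_D^A$. The eight sets $V_2^A$ partition $V_2$. *)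

theory Defs
  imports "Graph_Theory.Graph_Theory"
begin

text \<open>
  As in \<^theory>\<open>Graph_Theory.Digraph\<close>, an undirected graph is a symmetric digraph: every edge \<open>uv\<close>
  is present as both arcs \<open>(u, v)\<close> and \<open>(v, u)\<close>. The parts are meant to be pairwise disjoint.
\<close>

definition complete_tripartite :: "'a set \<Rightarrow> 'a set \<Rightarrow> 'a set \<Rightarrow> 'a pair_pre_digraph" where
  "complete_tripartite U V W = \<lparr> pverts = U \<union> V \<union> W,
     parcs = U \<times> V \<union> V \<times> U \<union> U \<times> W \<union> W \<times> U \<union> V \<times> W \<union> W \<times> V \<rparr>"

definition orientation :: "'a pair_pre_digraph \<Rightarrow> 'a pair_pre_digraph \<Rightarrow> bool" where
  "orientation D G \<longleftrightarrow> pverts D = pverts G \<and> parcs D \<subseteq> parcs G \<and>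
     (\<forall>(u, v) \<in> parcs G. (u, v) \<in> parcs D \<longleftrightarrow> (v, u) \<notin> parcs D)"

text \<open>
  With unit arc weights, \<open>wf_digraph.\<mu>\<close> is the directed distance (\<open>\<infinity>\<close> if there is no walk).
  The supremum is the maximum when the digraph is finite and nonempty.
\<close>

definition digraph_diameter :: "('a, 'b) pre_digraph \<Rightarrow> ereal" where
  "digraph_diameter D = (SUP (u, v) \<in> verts D \<times> verts D. wf_digraph.\<mu> D (\<lambda>_. 1) u v)"

definition N_set :: "'a pair_pre_digraph \<Rightarrow> (nat \<Rightarrow> 'a) \<Rightarrow> nat set \<Rightarrow> 'a set" where
  "N_set D x A = {w \<in> pverts D. (\<forall>i \<in> A. (x i, w) \<in> parcs D) \<and>
     (\<forall>j \<in> {1, 2, 3} - A. (w, x j) \<in> parcs D)}"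

lemma orientation_pair_digraph:
  assumes "pair_graph G" and "orientation D G"
  shows "pair_digraph D"
proof -
  interpret pair_graph G by fact
  have sub: "pverts D = pverts G" "parcs D \<subseteq> parcs G"
    using assms(2) by (auto simp: orientation_def)
  then have "fst e \<in> pverts D" "snd e \<in> pverts D" "fst e \<noteq> snd e" if "e \<in> parcs D" for e
    using that arc_fst_in_verts arc_snd_in_verts pair_no_loops by blast+
  then show ?thesis
  proof unfold_locales
    show "finite (parcs D)" using sub(2) pair_finite_arcs by (rule finite_subset)
  qed (use sub(1) pair_finite_verts in auto)
qed

lemma pair_graph_complete_tripartite:
  assumes "finite U" "finite V" "finite W"
    and "U \<inter> V = {}" "U \<inter> W = {}" "V \<inter> W = {}"
  shows "pair_graph (complete_tripartite U V W)"
  using assms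
  by unfold_locales (auto simp: complete_tripartite_def symmetric_def intro!: symI)

end

theory Submission
  imports Defs "HOL-Combinatorics.Multiset_Permutations"
begin

text \<open>Encode \<open>w \<in> V\<^sub>3\<close> by the pair \<open>(C w, T w)\<close> of its in-neighbourhoods in \<open>V\<^sub>1\<close> (as a set of indices)
  and in \<open>V\<^sub>2\<close>. Diameter two makes these pairs an antichain, and the paths of length two between \<open>w\<close>
  and \<open>V\<^sub>1 \<union> V\<^sub>2\<close> restrict them: if \<open>C w\<close> is comparable with \<open>A\<close>, then \<open>T w\<close> contains all or nothing of
  \<open>V\<^sub>2\<^sup>A\<close>. Let \<open>V\<^sub>2\<^sup>A\<close> and \<open>V\<^sub>2\<^sup>B\<close> be the nonempty classes. If \<open>A\<close> and \<open>B\<close> differ in one index, the pairs form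
  an antichain of subsets of a set with \<open>p + 1\<close> elements that misses a maximal chain, so Sperner's
  bound is strict. Otherwise Sperner's bound is applied for each value of \<open>C w\<close> separately, and the
  resulting sums of central binomial coefficients stay below the one for \<open>p + 1\<close>.\<close>

section \<open>Sperner's theorem by counting permutations\<close>

text \<open>Such a permutation is an arrangement of \<open>S\<close> followed by one of
  \<open>X - S\<close>; cutting after \<open>card S\<close> entries inverts concatenation.\<close>

lemma card_permutations_through:
  assumes "finite X" and "S \<subseteq> X"
  shows "card {xs \<in> permutations_of_set X. set (take (card S) xs) = S}
    = fact (card S) * fact (card X - card S)"
proof -
  let ?P = "permutations_of_set S \<times> permutations_of_set (X - S)"
  have fS: "finite S" using assms finite_subset by blast
  have "bij_betw (\<lambda>(ys, zs). ys @ zs) ?P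
      {xs \<in> permutations_of_set X. set (take (card S) xs) = S}"
  proof (rule bij_betwI[where g = "\<lambda>xs. (take (card S) xs, drop (card S) xs)"])
    show "(\<lambda>(ys, zs). ys @ zs) \<in> ?P \<rightarrow> {xs \<in> permutations_of_set X. set (take (card S) xs) = S}"
    proof (clarify, intro CollectI conjI)
      fix ys zs assume ys: "ys \<in> permutations_of_set S" and zs: "zs \<in> permutations_of_set (X - S)"
      show "ys @ zs \<in> permutations_of_set X"
        using ys zs assms(2) by (auto simp: permutations_of_set_def)
      show "set (take (card S) (ys @ zs)) = S"
        using permutations_of_setD(1)[OF ys] length_finite_permutations_of_set[OF ys] by simp
    qed
    show "(\<lambda>xs. (take (card S) xs, drop (card S) xs))
        \<in> {xs \<in> permutations_of_set X. set (take (card S) xs) = S} \<rightarrow> ?P"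
    proof (intro Pi_I, elim CollectE conjE, intro SigmaI)
      fix xs assume xs: "xs \<in> permutations_of_set X" and tk: "set (take (card S) xs) = S"
      have d: "distinct xs" "set xs = X" using xs by (auto dest: permutations_of_setD)
      show "take (card S) xs \<in> permutations_of_set S"
        using d tk by (intro permutations_of_setI) auto
      have "set (take (card S) xs) \<inter> set (drop (card S) xs) = {}"
        using d(1) by (simp add: set_take_disj_set_drop_if_distinct)
      moreover have "set (take (card S) xs) \<union> set (drop (card S) xs) = X"
        using d(2) by (metis append_take_drop_id set_append)
      ultimately show "drop (card S) xs \<in> permutations_of_set (X - S)"
        using d tk by (intro permutations_of_setI) auto
    qed
  qed (auto simp: length_finite_permutations_of_set)
  then have "card {xs \<in> permutations_of_set X. set (take (card S) xs) = S} = card ?P"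
    by (simp add: bij_betw_same_card)
  then show ?thesis
    using assms fS by (simp add: card_cartesian_product card_Diff_subset)
qed

text \<open>Lubell's double count: the permutations that list some \<open>S w\<close> first are disjoint for distinct \<open>w\<close>,
  and none of them lies in \<open>Q\<close>.\<close>

lemma sperner_permutations:
  assumes X: "finite X" and W: "finite W" and sub: "\<And>w. w \<in> W \<Longrightarrow> S w \<subseteq> X"
    and anti: "\<And>u w. u \<in> W \<Longrightarrow> w \<in> W \<Longrightarrow> S u \<subseteq> S w \<Longrightarrow> u = w"
    and Q: "Q \<subseteq> permutations_of_set X"
    and avoid: "\<And>xs w. xs \<in> Q \<Longrightarrow> w \<in> W \<Longrightarrow> set (take (card (S w)) xs) \<noteq> S w"
  shows "card W * fact (card X) + (card X choose (card X div 2)) * card Q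
    \<le> (card X choose (card X div 2)) * fact (card X)"
proof -
  let ?n = "card X" and ?M = "card X choose (card X div 2)"
  let ?P = "\<lambda>w. {xs \<in> permutations_of_set X. set (take (card (S w)) xs) = S w}"
  have disj: "?P u \<inter> ?P w = {}" if "u \<in> W" "w \<in> W" "u \<noteq> w" for u w
  proof (rule ccontr)
    assume "?P u \<inter> ?P w \<noteq> {}"
    then obtain xs where "set (take (card (S u)) xs) = S u" "set (take (card (S w)) xs) = S w"
      by blast
    \<comment> \<open>Two prefixes of one list are nested, so a common permutation contradicts the
      antichain property.\<close>
    then have "S u \<subseteq> S w \<or> S w \<subseteq> S u"
      by (metis nat_le_linear set_take_subset_set_take)
    then show False using anti that by blast
  qed
  have "(\<Sum>w\<in>W. card (?P w)) + card Q = card (\<Union>w\<in>W. ?P w) + card Q"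
    using W disj by (subst card_UN_disjoint) auto
  also have "\<dots> = card ((\<Union>w\<in>W. ?P w) \<union> Q)"
    using W Q avoid finite_subset[OF Q]
    by (intro card_Un_disjoint[symmetric]) auto
  also have "\<dots> \<le> card (permutations_of_set X)"
    using Q by (intro card_mono) auto
  finally have le: "(\<Sum>w\<in>W. card (?P w)) + card Q \<le> fact ?n"
    using X by simp
  \<comment> \<open>With \<open>k = card (S w)\<close>,
    \<open>n! = k! (n - k)! (n choose k)\<close>, and the last factor is at most the central
    coefficient.\<close>
  have "fact ?n \<le> ?M * card (?P w)" if "w \<in> W" for w
  proof -
    have "card (S w) \<le> ?n" using sub that X card_mono by blast
    then have "fact ?n = fact (card (S w)) * fact (?n - card (S w)) * (?n choose card (S w))"
      by (simp add: binomial_fact_lemma)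
    also have "\<dots> \<le> fact (card (S w)) * fact (?n - card (S w)) * ?M"
      by (intro mult_left_mono binomial_maximum) simp
    finally show ?thesis
      using card_permutations_through[OF X sub[OF that]] by (simp add: mult.commute)
  qed
  then have "card W * fact ?n \<le> ?M * (\<Sum>w\<in>W. card (?P w))"
    unfolding sum_distrib_left using sum_bounded_below[of W "fact ?n" "\<lambda>w. ?M * card (?P w)"] by simp
  then show ?thesis
    using mult_le_mono2[OF le, of ?M] by (simp add: algebra_simps)
qed

text \<open>The family is indexed by \<open>W\<close>; the last assumption includes injectivity of
  \<open>S\<close>, so \<open>card W\<close> is the size of the antichain.\<close>

corollary sperner:
  assumes "finite X" and "finite W" and "\<And>w. w \<in> W \<Longrightarrow> S w \<subseteq> X"
    and "\<And>u w. u \<in> W \<Longrightarrow> w \<in> W \<Longrightarrow> S u \<subseteq> S w \<Longrightarrow> u = w"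
  shows "card W \<le> card X choose (card X div 2)"
  using sperner_permutations[of X W S "{}"] assms by simp

text \<open>The prefixes of \<open>xs\<close> form a maximal chain. Taking \<open>Q = {xs}\<close>
  adds a positive binomial coefficient to the count, which makes the bound strict.\<close>

corollary sperner_avoiding_chain:
  assumes "finite W" and "\<And>w. w \<in> W \<Longrightarrow> S w \<subseteq> set xs" and "distinct xs"
    and "\<And>u w. u \<in> W \<Longrightarrow> w \<in> W \<Longrightarrow> S u \<subseteq> S w \<Longrightarrow> u = w"
    and "\<And>w. w \<in> W \<Longrightarrow> set (take (card (S w)) xs) \<noteq> S w"
  shows "card W < length xs choose (length xs div 2)"
proof -
  have l: "card (set xs) = length xs" using assms(3) by (rule distinct_card)
  have "card W * fact (length xs) + (length xs choose (length xs div 2))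
      \<le> (length xs choose (length xs div 2)) * fact (length xs)"
    using sperner_permutations[of "set xs" W S "{xs}"] assms by (simp add: permutations_of_set_def l)
  moreover have "0 < length xs choose (length xs div 2)" by simp
  ultimately have "card W * fact (length xs) < (length xs choose (length xs div 2)) * fact (length xs)"
    by linarith
  then show ?thesis by simp
qed

section \<open>Inequalities between central binomial coefficients\<close>

abbreviation (input) central :: "nat \<Rightarrow> nat" where
  "central n \<equiv> n choose (n div 2)"

lemma choose_add_one: "(n + 1) choose (k + 1) = (n choose k) + (n choose (k + 1))"
  by simp

lemma central_values: "central 2 = 2" "central 3 = 3" "central 4 = 6" "central 5 = 10"
proof -
  have "4 choose 2 = (6::nat)" "5 choose 2 = (10::nat)" by (simp_all add: eval_nat_numeral)
  then show "central 2 = 2" "central 3 = 3" "central 4 = 6" "central 5 = 10" by simp_all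
qed

text \<open>Pascal's rule, with the two middle entries of row \<open>2 * m + 1\<close> equal by
  symmetry.\<close>

lemma central_even_odd:
  "central (2 * m + 1) = (2 * m choose m) + (2 * m choose (m + 1))"
  "central (2 * m + 2) = 2 * ((2 * m choose m) + (2 * m choose (m + 1)))"
proof -
  have "(2 * m + 1) choose m = (2 * m + 1) choose (m + 1)"
    using binomial_symmetric[of m "2 * m + 1"] by simp
  then show "central (2 * m + 1) = (2 * m choose m) + (2 * m choose (m + 1))"
    "central (2 * m + 2) = 2 * ((2 * m choose m) + (2 * m choose (m + 1)))"
    by simp_all
qed

text \<open>Pascal's rule cancels the leading terms of both differences. At \<open>n = 4\<close> the
  second bound is an equality: \<open>3 * 6 + 2 = 20\<close>.\<close>

lemma central_step_bounds:
  assumes "4 \<le> n"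
  shows "central (n + 1) + central n + 3 \<le> central (n + 2)"
    and "3 * central n + 2 \<le> central (n + 2)"
proof -
  have "central (n + 1) + central n + 3 \<le> central (n + 2) \<and> 3 * central n + 2 \<le> central (n + 2)"
  proof (cases "even n")
    case True
    \<comment> \<open>Rows \<open>n - 1\<close> and \<open>n - 2\<close> become
      \<open>2 * r + 3\<close> and \<open>2 * r + 2\<close>, free of truncated subtraction.\<close>
    define r where "r = n div 2 - 2"
    have n: "n = 2 * (r + 2)" using True assms by (auto simp: r_def)
    let ?m = "r + 2"
    have eq: "2 * ?m = (2 * r + 3) + 1" "?m = (r + 1) + 1" "2 * r + 3 = (2 * r + 2) + 1" by simp_all
    have "2 * ?m choose ?m = 2 * (2 * r + 3 choose ?m)"
      using choose_add_one[of "2 * r + 3" "r + 1"] binomial_symmetric[of "r + 1" "2 * r + 3"]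
      unfolding eq(1) by (simp add: eval_nat_numeral)
    moreover have "2 * ?m choose (?m + 1) = (2 * r + 3 choose ?m) + (2 * r + 3 choose (?m + 1))"
      unfolding eq(1) by (rule choose_add_one)
    moreover have "2 * r + 3 choose ?m = (2 * r + 2 choose (r + 1)) + (2 * r + 2 choose (r + 2))"
      using choose_add_one[of "2 * r + 2" "r + 1"] unfolding eq by (simp only: add.assoc one_add_one)
    moreover have "1 \<le> 2 * r + 3 choose (?m + 1)" "1 \<le> 2 * r + 2 choose (r + 2)"
      "1 \<le> 2 * r + 2 choose (r + 1)"
      by (simp_all only: Suc_le_eq One_nat_def zero_less_binomial)
    moreover have "central n = 2 * ?m choose ?m"
      unfolding n by (simp only: nonzero_mult_div_cancel_left)
    moreover have "central (n + 1) = (2 * ?m choose ?m) + (2 * ?m choose (?m + 1))"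
      "central (n + 2) = 2 * ((2 * ?m choose ?m) + (2 * ?m choose (?m + 1)))"
      unfolding n by (rule central_even_odd)+
    \<comment> \<open>The two differences are \<open>y = u + t\<close>, at least 3, and
      \<open>2 * y - x = 2 * t\<close>, at least 2.\<close>
    moreover have "c\<^sub>1 + c\<^sub>0 + 3 \<le> c\<^sub>2 \<and> 3 * c\<^sub>0 + 2 \<le> c\<^sub>2"
      if "x = 2 * u" "y = u + t" "u = s + s'" "1 \<le> t" "1 \<le> s'" "1 \<le> s"
        "c\<^sub>0 = x" "c\<^sub>1 = x + y" "c\<^sub>2 = 2 * (x + y)" for c\<^sub>0 c\<^sub>1 c\<^sub>2 x y u t s s' :: nat
      using that by simp
    ultimately show ?thesis by blast
  next
    case False
    then obtain m where n: "n = 2 * m + 1" by (rule oddE)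
    let ?x = "2 * m choose m" and ?y = "2 * m choose (m + 1)" and ?z = "2 * m choose (m + 2)"
    have eq: "n + 1 = 2 * m + 2" "n + 2 = 2 * (m + 1) + 1" using n by simp_all
    have c: "central n = ?x + ?y" unfolding n by (rule central_even_odd)
    have c1: "central (n + 1) = 2 * (?x + ?y)" unfolding eq by (rule central_even_odd)
    have "central (n + 2) = (2 * (m + 1) choose (m + 1)) + (2 * (m + 1) choose (m + 2))"
      using central_even_odd(1)[of "m + 1"] unfolding eq(2) by (simp only: add.assoc one_add_one)
    also have "2 * (m + 1) choose (m + 1) = 2 * (?x + ?y)"
      using central_even_odd(2)[of m] by simp
    also have "2 * (m + 1) choose (m + 2) = ?x + 2 * ?y + ?z"
      by (simp add: numeral_eq_Suc)
    finally have c2: "central (n + 2) = 2 * (?x + ?y) + (?x + 2 * ?y + ?z)" .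
    have "3 \<le> ?y + ?z"
    proof -
      have m: "2 * m = (2 * m - 1) + 1" "2 \<le> m" using n assms by simp_all
      have "?y = (2 * m - 1 choose m) + (2 * m - 1 choose (m + 1))"
        using choose_add_one[of "2 * m - 1" m] unfolding m(1)[symmetric] .
      moreover have "1 \<le> 2 * m - 1 choose m" "1 \<le> 2 * m - 1 choose (m + 1)" "1 \<le> ?z"
        unfolding Suc_le_eq One_nat_def using m(2) by (intro zero_less_binomial, simp)+
      ultimately show ?thesis by linarith
    qed
    \<comment> \<open>Both differences equal \<open>y + z\<close>.\<close>
    moreover have "c\<^sub>1 + c\<^sub>0 + 3 \<le> c\<^sub>2 \<and> 3 * c\<^sub>0 + 2 \<le> c\<^sub>2"
      if "c\<^sub>0 = x + y" "c\<^sub>1 = 2 * (x + y)" "c\<^sub>2 = 2 * (x + y) + (x + 2 * y + z)" "3 \<le> y + z"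
      for c\<^sub>0 c\<^sub>1 c\<^sub>2 x y z :: nat
      using that by simp
    ultimately show ?thesis using c c1 c2 by blast
  qed
  then show "central (n + 1) + central n + 3 \<le> central (n + 2)"
    and "3 * central n + 2 \<le> central (n + 2)" by (rule conjunct1, rule conjunct2)
qed

lemma central_mono: "m \<le> n \<Longrightarrow> central m \<le> central n"
proof (induction n rule: dec_induct)
  case (step n)
  have "central n \<le> Suc n choose Suc (n div 2)" by simp
  also have "\<dots> \<le> central (Suc n)" by (rule binomial_maximum)
  finally show ?case using step by simp
qed simp

text \<open>Here \<open>a\<close> and \<open>b\<close> stand for the sizes of the two classes; the
  four left-hand sides are the totals that arise in \<open>sum_fibre_bound_lt\<close>.\<close>

lemma central_add_bounds:
  assumes p: "5 \<le> p" and ab: "a + b = p" "1 \<le> a" "1 \<le> b"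
  shows "central p + central a + central b + 1 < central (p + 1)"
    and "2 * central a + 2 * central b + 2 < central (p + 1)"
    and "3 * central a + 1 < central (p + 1)"
    and "3 * central b + 1 < central (p + 1)"
proof -
  obtain n where n: "p = n + 1" "4 \<le> n" using p by (cases p) auto
  \<comment> \<open>The split \<open>1 + n\<close> attains equality. Otherwise the smaller part is
    at most \<open>n - 2\<close> and the larger at most \<open>n - 1\<close>.\<close>
  have *: "central c + central d \<le> central n + 1"
    if cd: "c + d = n + 1" "1 \<le> c" "c \<le> d" for c d
  proof (cases "c = 1")
    case True
    then show ?thesis using cd by simp
  next
    case False
    define k where "k = n - 2"
    have k: "n = k + 2" "2 \<le> k" using n by (auto simp: k_def)
    have "central (k + 1) + central k \<le> central (k + 2)"
    proof (cases "4 \<le> k")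
      case True
      then show ?thesis using central_step_bounds(1)[of k] by simp
    next
      case False
      then have "k = 2 \<or> k = 3" using k by auto
      then show ?thesis using central_values by (elim disjE) simp_all
    qed
    moreover have "central c \<le> central k" "central d \<le> central (k + 1)"
      using False cd n k by (auto intro!: central_mono)
    ultimately show ?thesis unfolding k(1) by linarith
  qed
  have sum: "central a + central b \<le> central n + 1"
    using *[of a b] *[of b a] ab n by (cases "a \<le> b") (auto simp: add.commute)
  have "central a \<le> central n" "central b \<le> central n"
    using ab n by (auto intro!: central_mono)
  moreover have "central 4 \<le> central n" using n by (intro central_mono) auto
  then have "6 \<le> central n" by (simp only: central_values)
  ultimately show "central p + central a + central b + 1 < central (p + 1)"
    "2 * central a + 2 * central b + 2 < central (p + 1)"
    "3 * central a + 1 < central (p + 1)"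
    "3 * central b + 1 < central (p + 1)"
    using sum central_step_bounds[OF n(2)] unfolding n(1) by (simp_all add: add.assoc)
qed

section \<open>From the diameter to paths of length two\<close>

lemma walk_of_length_le_two:
  assumes wf: "wf_digraph (with_proj D)" and diam: "digraph_diameter (with_proj D) = 2"
    and uv: "u \<in> pverts D" "v \<in> pverts D" "u \<noteq> v" "(u, v) \<notin> parcs D"
  obtains y where "(u, y) \<in> parcs D" "(y, v) \<in> parcs D"
proof -
  interpret wf_digraph "with_proj D" by (rule wf)
  have "\<mu> (\<lambda>_. 1) u v \<le> digraph_diameter (with_proj D)"
    unfolding digraph_diameter_def using uv by (intro SUP_upper2[of "(u, v)"]) auto
  \<comment> \<open>A strict bound on the infimum defining the distance yields an actual walk of
    smaller cost.\<close>
  also have "\<dots> < 3" using diam by simp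
  finally obtain es where es: "awalk u es v" "ereal (awalk_cost (\<lambda>_. 1) es) < 3"
    unfolding \<mu>_def INF_less_iff by auto
  have "awalk_cost (\<lambda>_. 1) es = real (length es)"
    unfolding awalk_cost_def by (induction es) auto
  with es(2) have "length es < 3"
    by (metis ereal_less_eq(3) linorder_not_less numeral_eq_ereal of_nat_numeral of_nat_le_iff)
  then consider "es = []" | e where "es = [e]" | e f where "es = [e, f]"
    by (cases es rule: remdups_adj.cases) (auto simp: less_Suc_eq)
  then show thesis
  proof cases
    case 1
    then show ?thesis using es(1) uv by (simp add: awalk_def)
  next
    case 2
    then show ?thesis using es(1) uv by (cases e) (auto simp: awalk_def)
  next
    case 3
    then show ?thesis using es(1) that by (cases e; cases f) (auto simp: awalk_def)
  qed
qed

section \<open>Summing the fibre bounds over the index sets\<close>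

text \<open>A list, so that a sum over it unfolds to eight explicit terms.\<close>

definition index_subsets :: "nat set list" where
  "index_subsets = [{}, {1}, {2}, {3}, {1, 2}, {1, 3}, {2, 3}, {1, 2, 3}]"

lemma in_index_subsets_iff: "c \<in> set index_subsets \<longleftrightarrow> c \<subseteq> {1, 2, 3}"
proof -
  have "set index_subsets = Pow {1, 2, 3}"
    by (simp add: index_subsets_def Pow_insert insert_commute)
  then show ?thesis by simp
qed

text \<open>The inequality avoids deciding whether the eight explicit sets are distinct.\<close>

lemma sum_set_le_sum_list:
  fixes g :: "'b \<Rightarrow> nat"
  shows "sum g (set xs) \<le> (\<Sum>x\<leftarrow>xs. g x)"
  by (induction xs) (auto simp: sum.insert_if)

text \<open>Bounds the number of \<open>w\<close> with \<open>C w = c\<close>: there is none if \<open>c\<close> is a type or violates \<open>in_C\<close> or \<open>notin_C\<close>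
  below, and otherwise \<open>T w\<close> is undetermined only on the vertices whose type is incomparable with
  \<open>c\<close>. Equality of index sets is written as two inclusions because simp decides inclusion, but not
  equality, of explicit sets.\<close>

definition fibre_bound :: "nat set \<Rightarrow> nat set \<Rightarrow> nat \<Rightarrow> nat \<Rightarrow> nat \<Rightarrow> nat set \<Rightarrow> nat" where
  "fibre_bound A B f\<^sub>V f\<^sub>A f\<^sub>B c =
    (if c \<subseteq> A \<and> A \<subseteq> c \<or> c \<subseteq> B \<and> B \<subseteq> c
      \<or> \<not> (\<forall>i\<in>{1, 2, 3}. (i \<in> A \<and> i \<in> B \<longrightarrow> i \<notin> c) \<and> (i \<notin> A \<and> i \<notin> B \<longrightarrow> i \<in> c)) then 0
     else if \<not> c \<subseteq> A \<and> \<not> A \<subseteq> c then (if \<not> c \<subseteq> B \<and> \<not> B \<subseteq> c then f\<^sub>V else f\<^sub>A)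
     else if \<not> c \<subseteq> B \<and> \<not> B \<subseteq> c then f\<^sub>B else 1)"

text \<open>Only indices in exactly one of \<open>A\<close>, \<open>B\<close> are free in
  \<open>c\<close>. With two free indices the total is \<open>3 * f\<^sub>A + 1\<close> or
  \<open>3 * f\<^sub>B + 1\<close> for comparable types, and
  \<open>f\<^sub>V + f\<^sub>A + f\<^sub>B + 1\<close> for incomparable ones. With three the types
  are complementary: the total is \<open>2 * f\<^sub>A + 2 * f\<^sub>B + 2\<close>, or 6 for the
  empty and the full set, where \<open>f\<^sub>A\<close> and \<open>f\<^sub>B\<close> must be
  positive.\<close>

lemma sum_fibre_bound_lt:
  fixes f\<^sub>V f\<^sub>A f\<^sub>B N :: nat
  assumes "A \<in> set index_subsets" and "B \<in> set index_subsets"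
    and "\<not> (A \<subseteq> B \<and> (\<exists>i\<in>{1, 2, 3}. B \<subseteq> insert i A))"
    and "\<not> (B \<subseteq> A \<and> (\<exists>i\<in>{1, 2, 3}. A \<subseteq> insert i B))"
    and "f\<^sub>V + f\<^sub>A + f\<^sub>B + 1 < N" and "2 * f\<^sub>A + 2 * f\<^sub>B + 2 < N"
    and "3 * f\<^sub>A + 1 < N" and "3 * f\<^sub>B + 1 < N" and "1 \<le> f\<^sub>A" and "1 \<le> f\<^sub>B"
  shows "(\<Sum>c\<leftarrow>index_subsets. fibre_bound A B f\<^sub>V f\<^sub>A f\<^sub>B c) < N"
proof -
  have A: "A = {} \<or> A = {1} \<or> A = {2} \<or> A = {3} \<or> A = {1, 2} \<or> A = {1, 3} \<or> A = {2, 3} \<or> A = {1, 2, 3}"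
    and B: "B = {} \<or> B = {1} \<or> B = {2} \<or> B = {3} \<or> B = {1, 2} \<or> B = {1, 3} \<or> B = {2, 3} \<or> B = {1, 2, 3}"
    using assms(1,2) by (simp_all add: index_subsets_def)
  show ?thesis
    using A B assms(3-) by (elim disjE) (simp_all add: index_subsets_def fibre_bound_def)
qed

section \<open>The extremal problem for pairs of in-neighbourhoods\<close>

text \<open>\<open>type v\<close> is the index set \<open>A\<close> with \<open>v \<in> V\<^sub>2\<^sup>A\<close>. Each of the last five assumptions comes from one kind of
  path of length two: between vertices of \<open>W\<close>, from \<open>v\<close> to \<open>w\<close>, from \<open>w\<close> to \<open>v\<close>, from \<open>w\<close> to \<open>x\<^sub>i\<close>, from \<open>x\<^sub>i\<close>
  to \<open>w\<close>.\<close>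

locale in_neighbourhoods =
  fixes V :: "'v set" and W :: "'w set" and type :: "'v \<Rightarrow> nat set"
    and C :: "'w \<Rightarrow> nat set" and T :: "'w \<Rightarrow> 'v set"
  assumes finite_V: "finite V" and finite_W: "finite W"
    and C_sub: "w \<in> W \<Longrightarrow> C w \<subseteq> {1, 2, 3}" and T_sub: "w \<in> W \<Longrightarrow> T w \<subseteq> V"
    and antichain: "u \<in> W \<Longrightarrow> w \<in> W \<Longrightarrow> C u \<subseteq> C w \<Longrightarrow> T u \<subseteq> T w \<Longrightarrow> u = w"
    and above: "w \<in> W \<Longrightarrow> v \<in> V \<Longrightarrow> C w \<subseteq> type v \<Longrightarrow> v \<in> T w"
    and below: "w \<in> W \<Longrightarrow> v \<in> V \<Longrightarrow> type v \<subseteq> C w \<Longrightarrow> v \<notin> T w"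
    and in_C: "w \<in> W \<Longrightarrow> i \<in> C w \<Longrightarrow> \<exists>v\<in>V - T w. i \<notin> type v"
    and notin_C: "w \<in> W \<Longrightarrow> i \<in> {1, 2, 3} - C w \<Longrightarrow> \<exists>v\<in>T w. i \<in> type v"
begin

text \<open>\<open>in_C\<close> needs a type omitting \<open>i\<close>, impossible if both contain
  it; \<open>notin_C\<close> needs a type containing \<open>i\<close>, impossible if neither
  does.\<close>

lemma C_fixed_outside:
  assumes "w \<in> W" and "type ` V = {A, B}"
  shows "A \<inter> B \<inter> C w = {}" and "{1, 2, 3} - (A \<union> B) \<subseteq> C w"
proof -
  have "type v \<in> {A, B}" if "v \<in> V" for v using assms(2) that by blast
  then show "A \<inter> B \<inter> C w = {}" and "{1, 2, 3} - (A \<union> B) \<subseteq> C w"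
    using in_C[OF assms(1)] notin_C[OF assms(1)] T_sub[OF assms(1)] by blast+
qed

text \<open>When the two types differ in one index \<open>i\<close>, only \<open>i \<in> C w\<close> is undetermined, so \<open>w\<close> is
  encoded by \<open>T w\<close> together with an extra point \<open>None\<close> marking \<open>i \<in> C w\<close>. The chain that
  exhausts \<open>V\<^sup>A\<close>, then adds \<open>None\<close>, then the rest, meets no encoded set.\<close>

lemma card_lt_adjacent_types:
  assumes types: "type ` V = {A, insert i A}" and i: "i \<in> {1, 2, 3} - A"
  shows "card W < central (card V + 1)"
proof -
  define S where "S w = Some ` T w \<union> (if i \<in> C w then {None} else {})" for w
  have fin: "finite {v \<in> V. type v = A}" "finite {v \<in> V. type v \<noteq> A}" using finite_V by auto
  obtain as where as: "set as = {v \<in> V. type v = A}" "distinct as"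
    using finite_distinct_list[OF fin(1)] by blast
  obtain bs where bs: "set bs = {v \<in> V. type v \<noteq> A}" "distinct bs"
    using finite_distinct_list[OF fin(2)] by blast
  define xs where "xs = map Some as @ None # map Some bs"
  have set_xs: "set xs = insert None (Some ` V)" using as bs by (auto simp: xs_def)
  have dist: "distinct xs" using as bs by (auto simp: xs_def distinct_map)
  have "length xs = card (insert None (Some ` V))"
    using dist set_xs distinct_card by metis
  then have len: "length xs = card V + 1"
    using finite_V by (simp add: card_image)
  have "card W < central (length xs)"
  proof (rule sperner_avoiding_chain[OF finite_W _ dist, where S = S])
    show "S w \<subseteq> set xs" if "w \<in> W" for w
      using T_sub[OF that] by (auto simp: S_def set_xs)
    show "u = w" if uw: "u \<in> W" "w \<in> W" "S u \<subseteq> S w" for u w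
    proof (rule antichain)
      show "T u \<subseteq> T w" using uw(3) by (auto simp: S_def split: if_splits)
      have "i \<in> C u \<longrightarrow> i \<in> C w" using uw(3) by (auto simp: S_def split: if_splits)
      \<comment> \<open>Such a \<open>j\<close> lies in neither type, hence in every
        \<open>C w\<close>.\<close>
      moreover have "j \<in> C w" if "j \<in> C u" "j \<noteq> i" for j
      proof -
        have "j \<notin> A" using C_fixed_outside(1)[OF uw(1) types] that by auto
        then show ?thesis
          using C_fixed_outside(2)[OF uw(2) types] C_sub[OF uw(1)] that by auto
      qed
      ultimately show "C u \<subseteq> C w" by blast
    qed (use uw in auto)
    show "set (take (card (S w)) xs) \<noteq> S w" if w: "w \<in> W" for w
    proof
      assume eq: "set (take (card (S w)) xs) = S w"
      \<comment> \<open>The prefix either stops before \<open>None\<close>, leaving only vertices of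
        type \<open>A\<close> in \<open>T w\<close> against \<open>notin_C\<close>, or contains
        \<open>None\<close> and all of that class, against \<open>in_C\<close>.\<close>
      show False
      proof (cases "card (S w) \<le> length as")
        case True
        then have sub: "S w \<subseteq> Some ` set as"
          using eq set_take_subset[of "card (S w)" as] by (auto simp: xs_def take_map)
        then have "i \<notin> C w" by (auto simp: S_def)
        with i obtain v where "v \<in> T w" "i \<in> type v" using notin_C[OF w] by blast
        then show False using sub as i by (auto simp: S_def)
      next
        case False
        then have "insert None (Some ` set as) \<subseteq> set (take (card (S w)) xs)"
          by (auto simp: xs_def take_Cons')
        then have "insert None (Some ` set as) \<subseteq> S w" unfolding eq .
        then have "i \<in> C w" "set as \<subseteq> T w" by (auto simp: S_def split: if_splits)
        with in_C[OF w] obtain v where "v \<in> V - T w" "i \<notin> type v" by blast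
        then show False using \<open>set as \<subseteq> T w\<close> as types by auto
      qed
    qed
  qed
  then show ?thesis unfolding len .
qed

text \<open>On a fibre of \<open>C\<close> the sets \<open>T w\<close> alone form an antichain. By
  \<open>above\<close> and \<open>below\<close> they agree on vertices with type comparable to
  \<open>c\<close>, so they remain an antichain after these are removed.\<close>

lemma card_fibre_le:
  "card {w \<in> W. C w = c} \<le> central (card {v \<in> V. \<not> c \<subseteq> type v \<and> \<not> type v \<subseteq> c})"
proof (rule sperner[where S = "\<lambda>w. {v \<in> T w. \<not> c \<subseteq> type v \<and> \<not> type v \<subseteq> c}"])
  fix u w
  assume u: "u \<in> {w \<in> W. C w = c}" and w: "w \<in> {w \<in> W. C w = c}"
    and sub: "{v \<in> T u. \<not> c \<subseteq> type v \<and> \<not> type v \<subseteq> c} \<subseteq> {v \<in> T w. \<not> c \<subseteq> type v \<and> \<not> type v \<subseteq> c}"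
  have "T u \<subseteq> T w"
  proof
    fix v assume v: "v \<in> T u"
    then have "v \<in> V" "\<not> type v \<subseteq> c" using T_sub below u by blast+
    then show "v \<in> T w" using sub v above w by blast
  qed
  then show "u = w" using antichain u w by blast
qed (use finite_V finite_W T_sub in auto)

lemma card_fibre_le_bound:
  assumes types: "type ` V = {A, B}"
  shows "card {w \<in> W. C w = c} \<le> fibre_bound A B (central (card V))
    (central (card {v \<in> V. type v = A})) (central (card {v \<in> V. type v = B})) c"
proof (cases "{w \<in> W. C w = c} = {}")
  case True
  then show ?thesis by (metis card.empty le0)
next
  case False
  then obtain w where w: "w \<in> W" "C w = c" by blast
  have ty: "type v = A \<or> type v = B" if "v \<in> V" for v using types that by blast
  \<comment> \<open>Equality would put \<open>v\<close> both inside and outside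
    \<open>T w\<close>.\<close>
  have "c \<noteq> type v" if "v \<in> V" for v using above below w that by blast
  then have ne: "c \<noteq> A" "c \<noteq> B" using types by blast+
  have fixed: "\<forall>i\<in>{1, 2, 3}. (i \<in> A \<and> i \<in> B \<longrightarrow> i \<notin> c) \<and> (i \<notin> A \<and> i \<notin> B \<longrightarrow> i \<in> c)"
    using C_fixed_outside[OF w(1) types] w(2) by blast
  have eq: "{v \<in> V. \<not> c \<subseteq> type v \<and> \<not> type v \<subseteq> c}
    = (if \<not> c \<subseteq> A \<and> \<not> A \<subseteq> c then (if \<not> c \<subseteq> B \<and> \<not> B \<subseteq> c then V else {v \<in> V. type v = A})
       else if \<not> c \<subseteq> B \<and> \<not> B \<subseteq> c then {v \<in> V. type v = B} else {})" (is "?l = ?r")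
  proof (intro set_eqI)
    fix v
    show "v \<in> ?l \<longleftrightarrow> v \<in> ?r"
    proof (cases "v \<in> V")
      case True
      from ty[OF True] show ?thesis using True by (elim disjE) auto
    qed simp
  qed
  have "\<not> (c \<subseteq> A \<and> A \<subseteq> c \<or> c \<subseteq> B \<and> B \<subseteq> c)"
    using ne by blast
  moreover have "\<not> (P \<or> Q \<or> \<not> R)" if "\<not> (P \<or> Q)" R for P Q R using that by blast
  ultimately have cond: "\<not> (c \<subseteq> A \<and> A \<subseteq> c \<or> c \<subseteq> B \<and> B \<subseteq> c
      \<or> \<not> (\<forall>i\<in>{1, 2, 3}. (i \<in> A \<and> i \<in> B \<longrightarrow> i \<notin> c) \<and> (i \<notin> A \<and> i \<notin> B \<longrightarrow> i \<in> c)))"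
    using fixed by iprover
  \<comment> \<open>The nonempty fibre excludes the zero branch; the final value 1 is
    \<open>central 0\<close>, when no class is incomparable with \<open>c\<close>.\<close>
  have "fibre_bound A B f\<^sub>V f\<^sub>A f\<^sub>B c
    = (if \<not> c \<subseteq> A \<and> \<not> A \<subseteq> c then (if \<not> c \<subseteq> B \<and> \<not> B \<subseteq> c then f\<^sub>V else f\<^sub>A)
       else if \<not> c \<subseteq> B \<and> \<not> B \<subseteq> c then f\<^sub>B else 1)" for f\<^sub>V f\<^sub>A f\<^sub>B
    unfolding fibre_bound_def by (rule if_not_P[OF cond])
  then have "fibre_bound A B (central (card V))
    (central (card {v \<in> V. type v = A})) (central (card {v \<in> V. type v = B})) c
    = central (card {v \<in> V. \<not> c \<subseteq> type v \<and> \<not> type v \<subseteq> c})"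
    unfolding eq
    by (cases "\<not> c \<subseteq> A \<and> \<not> A \<subseteq> c"; cases "\<not> c \<subseteq> B \<and> \<not> B \<subseteq> c")
      (simp_all only: if_True if_False simp_thms card.empty div_0 binomial_n_0)
  then show ?thesis using card_fibre_le[of c] by simp
qed

lemma card_lt_central:
  assumes types: "type ` V = {A, B}" and ne: "A \<noteq> B" and "A \<subseteq> {1, 2, 3}" "B \<subseteq> {1, 2, 3}"
    and V: "5 \<le> card V"
  shows "card W < central (card V + 1)"
proof -
  consider i where "i \<in> {1, 2, 3} - A" "B = insert i A" | i where "i \<in> {1, 2, 3} - B" "A = insert i B"
    | "\<not> (A \<subseteq> B \<and> (\<exists>i\<in>{1, 2, 3}. B \<subseteq> insert i A))" "\<not> (B \<subseteq> A \<and> (\<exists>i\<in>{1, 2, 3}. A \<subseteq> insert i B))"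
  proof -
    have "\<exists>i\<in>{1, 2, 3} - A'. B' = insert i A'"
      if "A' \<noteq> B'" "A' \<subseteq> B'" "\<exists>i\<in>{1, 2, 3}. B' \<subseteq> insert i A'" for A' B' :: "nat set"
    proof -
      from that(3) obtain i where i: "i \<in> {1, 2, 3}" "B' \<subseteq> insert i A'" by (rule bexE)
      then have "i \<in> B' - A'" using that(1,2) by blast
      then show ?thesis using i that(2) by (intro bexI[of _ i]) auto
    qed
    from this[of A B] this[of B A] show ?thesis using that ne by metis
  qed
  then show ?thesis
  proof cases
    case 1
    then show ?thesis using card_lt_adjacent_types types by blast
  next
    case 2
    then show ?thesis using card_lt_adjacent_types[of B i] types by (simp add: insert_commute)
  next
    case 3
    define a b where "a = card {v \<in> V. type v = A}" and "b = card {v \<in> V. type v = B}"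
    have "type v \<in> {A, B}" if "v \<in> V" for v using types that by blast
    then have Vun: "{v \<in> V. type v = A} \<union> {v \<in> V. type v = B} = V" by blast
    have "a + b = card V"
      unfolding a_def b_def using finite_V ne
      by (subst card_Un_disjoint[symmetric]) (auto simp: Vun)
    moreover have "A \<in> type ` V" "B \<in> type ` V" using types by simp_all
    then have "{v \<in> V. type v = A} \<noteq> {}" "{v \<in> V. type v = B} \<noteq> {}" by auto
    then have "1 \<le> a" "1 \<le> b" using finite_V by (auto simp: a_def b_def Suc_le_eq card_gt_0_iff)
    ultimately have bounds: "central (card V) + central a + central b + 1 < central (card V + 1)"
      "2 * central a + 2 * central b + 2 < central (card V + 1)"
      "3 * central a + 1 < central (card V + 1)" "3 * central b + 1 < central (card V + 1)"
      using central_add_bounds[OF V] by blast+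
    have sets: "A \<in> set index_subsets" "B \<in> set index_subsets"
      using assms(3,4) by (simp_all add: in_index_subsets_iff)
    have pos: "1 \<le> central a" "1 \<le> central b" by (simp_all add: Suc_le_eq)
    \<comment> \<open>The types are not adjacent, so \<open>W\<close> is counted fibre by
      fibre.\<close>
    have "W \<subseteq> (\<Union>c\<in>set index_subsets. {w \<in> W. C w = c})"
      using C_sub by (auto simp: in_index_subsets_iff)
    then have "card W \<le> card (\<Union>c\<in>set index_subsets. {w \<in> W. C w = c})"
      using finite_W by (intro card_mono) auto
    also have "\<dots> \<le> (\<Sum>c\<in>set index_subsets. card {w \<in> W. C w = c})"
      by (rule card_UN_le) simp
    also have "\<dots> \<le> (\<Sum>c\<in>set index_subsets. fibre_bound A B (central (card V)) (central a) (central b) c)"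
      unfolding a_def b_def by (intro sum_mono card_fibre_le_bound types)
    also have "\<dots> \<le> (\<Sum>c\<leftarrow>index_subsets. fibre_bound A B (central (card V)) (central a) (central b) c)"
      by (rule sum_set_le_sum_list)
    also have "\<dots> < central (card V + 1)"
      by (rule sum_fibre_bound_lt) fact+
    finally show ?thesis .
  qed
qed

end

section \<open>Reduction of the orientation to in-neighbourhoods\<close>

theorem theorem4p7:
  fixes D :: "'a pair_pre_digraph"
    and x :: "nat \<Rightarrow> 'a"
    and V1 V2 V3 :: "'a set"
    and p q :: nat
  assumes "5 \<le> p" and "p \<le> q"
    and "V1 = {x 1, x 2, x 3}" and "card V1 = 3"
    and "finite V2" and "card V2 = p"
    and "finite V3" and "card V3 = q"
    and "V1 \<inter> V2 = {}" and "V1 \<inter> V3 = {}" and "V2 \<inter> V3 = {}"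
    and "orientation D (complete_tripartite V1 V2 V3)"
    and "strongly_connected (with_proj D)"
    and "digraph_diameter (with_proj D) = 2"
    and "card {A \<in> Pow {1, 2, 3}. V2 \<inter> N_set D x A \<noteq> {}} = 2"
  shows "q \<le> ((p + 1) choose ((p + 1) div 2)) - 1"
proof -
  have V1: "V1 = x ` {1, 2, 3}" using assms(3) by simp
  have "finite V1" using V1 by simp
  then have "pair_graph (complete_tripartite V1 V2 V3)"
    using assms by (intro pair_graph_complete_tripartite) auto
  then interpret D: pair_digraph D
    using assms(12) by (rule orientation_pair_digraph)
  have wf: "wf_digraph (with_proj D)" by unfold_locales
  have verts: "pverts D = V1 \<union> V2 \<union> V3"
    using assms(12) by (simp add: orientation_def complete_tripartite_def)
  have arcs: "parcs D \<subseteq> V1 \<times> V2 \<union> V2 \<times> V1 \<union> V1 \<times> V3 \<union> V3 \<times> V1 \<union> V2 \<times> V3 \<union> V3 \<times> V2"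
    using assms(12) by (simp add: orientation_def complete_tripartite_def)
  have orient: "(u, v) \<in> parcs D \<longleftrightarrow> (v, u) \<notin> parcs D"
    if "(u, v) \<in> V1 \<times> V2 \<union> V1 \<times> V3 \<union> V2 \<times> V3" for u v
  proof -
    have "(u, v) \<in> parcs (complete_tripartite V1 V2 V3)"
      using that by (auto simp: complete_tripartite_def)
    then show ?thesis using assms(12) unfolding orientation_def by blast
  qed
  have adj: "y \<in> V1 \<union> V2" if "(y, w) \<in> parcs D \<or> (w, y) \<in> parcs D" "w \<in> V3" for y w
    using that arcs assms(9-11) by blast
  have adj2: "y \<in> V1 \<union> V3" if "(y, v) \<in> parcs D \<or> (v, y) \<in> parcs D" "v \<in> V2" for y v
    using that arcs assms(9-11) by blast
  have adj1: "y \<in> V2 \<union> V3" if "(y, v) \<in> parcs D \<or> (v, y) \<in> parcs D" "v \<in> V1" for y v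
    using that arcs assms(9-11) by blast
  have walk: "\<exists>y. (u, y) \<in> parcs D \<and> (y, v) \<in> parcs D"
    if "u \<in> V1 \<union> V2 \<union> V3" "v \<in> V1 \<union> V2 \<union> V3" "u \<noteq> v" "(u, v) \<notin> parcs D" for u v
    using walk_of_length_le_two[OF wf assms(14)] that verts by blast
  define A_of where "A_of v = {i \<in> {1, 2, 3}. (x i, v) \<in> parcs D}" for v
  define T where "T w = {v \<in> V2. (v, w) \<in> parcs D}" for w
  have A_of_iff: "i \<in> A_of v \<longleftrightarrow> (x i, v) \<in> parcs D" "i \<notin> A_of v \<longleftrightarrow> (v, x i) \<in> parcs D"
    if "i \<in> {1, 2, 3}" "v \<in> V2 \<union> V3" for i v
    using orient[of "x i" v] that V1 by (auto simp: A_of_def)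
  have T_iff: "v \<in> T w \<longleftrightarrow> (v, w) \<in> parcs D" "v \<notin> T w \<longleftrightarrow> (w, v) \<in> parcs D"
    if "v \<in> V2" "w \<in> V3" for v w
    using orient[of v w] that by (auto simp: T_def)
  interpret in_neighbourhoods V2 V3 A_of A_of T
  proof
    fix u w assume uw: "u \<in> V3" "w \<in> V3" "A_of u \<subseteq> A_of w" "T u \<subseteq> T w"
    show "u = w"
    proof (rule ccontr)
      assume "u \<noteq> w"
      \<comment> \<open>The midpoint of a path from \<open>w\<close> to \<open>u\<close> is an
        in-neighbour of \<open>u\<close> but not of \<open>w\<close>.\<close>
      moreover have "(w, u) \<notin> parcs D" using adj[of w u] uw assms(10,11) by blast
      ultimately obtain y where y: "(w, y) \<in> parcs D" "(y, u) \<in> parcs D"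
        using walk[of w u] uw by auto
      then consider i where "i \<in> {1, 2, 3}" "y = x i" | "y \<in> V2" using adj[of y u] uw V1 by blast
      then show False
      proof cases
        case 1
        then have "i \<in> A_of u" "i \<notin> A_of w"
          using y A_of_iff(1)[of i u] A_of_iff(2)[of i w] uw(1,2) by blast+
        then show False using uw(3) by blast
      next
        case 2
        then have "y \<in> T u" "y \<notin> T w"
          using y T_iff(1)[OF 2 uw(1)] T_iff(2)[OF 2 uw(2)] by blast+
        then show False using uw(4) by blast
      qed
    qed
  next
    fix w v assume w: "w \<in> V3" and v: "v \<in> V2"
    \<comment> \<open>A midpoint between \<open>V2\<close> and \<open>V3\<close> can only lie in
      \<open>V1\<close>.\<close>
    have V1_between: "\<exists>i\<in>{1, 2, 3}. y = x i"
      if "(w, y) \<in> parcs D \<or> (y, w) \<in> parcs D" "(v, y) \<in> parcs D \<or> (y, v) \<in> parcs D" for y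
      using adj[of y w] adj2[of y v] that v w V1 assms(11) by blast
    have "v \<noteq> w" using v w assms(11) by blast
    show "v \<in> T w" if "A_of w \<subseteq> A_of v"
    proof (rule ccontr)
      assume "v \<notin> T w"
      then obtain y where y: "(v, y) \<in> parcs D" "(y, w) \<in> parcs D"
        using walk[of v w] T_iff[OF v w] v w \<open>v \<noteq> w\<close> by auto
      then obtain i where i: "i \<in> {1, 2, 3}" "y = x i" using V1_between by blast
      then have "i \<in> A_of w" "i \<notin> A_of v"
        using y A_of_iff(1)[of i w] A_of_iff(2)[of i v] v w by blast+
      then show False using that by blast
    qed
    show "v \<notin> T w" if "A_of v \<subseteq> A_of w"
    proof
      assume "v \<in> T w"
      then have "(w, v) \<notin> parcs D" using T_iff[OF v w] by blast
      then obtain y where y: "(w, y) \<in> parcs D" "(y, v) \<in> parcs D"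
        using walk[of w v] v w \<open>v \<noteq> w\<close> by auto
      then obtain i where i: "i \<in> {1, 2, 3}" "y = x i" using V1_between by blast
      then have "i \<notin> A_of w" "i \<in> A_of v"
        using y A_of_iff(2)[of i w] A_of_iff(1)[of i v] v w by blast+
      then show False using that by blast
    qed
  next
    fix w i assume w: "w \<in> V3"
    have V2_between: "y \<in> V2"
      if "(w, y) \<in> parcs D \<or> (y, w) \<in> parcs D" "(x i, y) \<in> parcs D \<or> (y, x i) \<in> parcs D"
        "i \<in> {1, 2, 3}" for y
      using adj[of y w] adj1[of y "x i"] that w V1 assms(9,10) by blast
    have V1V3: "x i \<in> V1 \<and> x i \<noteq> w" if "i \<in> {1, 2, 3}" using that V1 w assms(10) by blast
    show "\<exists>v\<in>V2 - T w. i \<notin> A_of v" if i: "i \<in> A_of w"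
    proof -
      have i3: "i \<in> {1, 2, 3}" using i by (simp add: A_of_def)
      then have "(w, x i) \<notin> parcs D" using A_of_iff(2)[of i w] i w by blast
      then obtain y where y: "(w, y) \<in> parcs D" "(y, x i) \<in> parcs D"
        using walk[of w "x i"] V1V3[OF i3] w by auto
      then have v: "y \<in> V2" using V2_between i3 by blast
      then have "i \<notin> A_of y" "y \<notin> T w"
        using y A_of_iff(2)[OF i3, of y] T_iff(2)[OF v w] by blast+
      then show ?thesis using v by blast
    qed
    show "\<exists>v\<in>T w. i \<in> A_of v" if i: "i \<in> {1, 2, 3} - A_of w"
    proof -
      have i3: "i \<in> {1, 2, 3}" using i by simp
      then have "(x i, w) \<notin> parcs D" using A_of_iff(1)[of i w] i w by blast
      then obtain y where y: "(x i, y) \<in> parcs D" "(y, w) \<in> parcs D"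
        using walk[of "x i" w] V1V3[OF i3] w by auto
      then have v: "y \<in> V2" using V2_between i3 by blast
      then have "i \<in> A_of y" "y \<in> T w"
        using y A_of_iff(1)[OF i3, of y] T_iff(1)[OF v w] by blast+
      then show ?thesis by blast
    qed
  next
    show "finite V2" "finite V3" by fact+
    show "A_of w \<subseteq> {1, 2, 3}" "T w \<subseteq> V2" for w by (auto simp only: A_of_def T_def)
  qed
  have N_iff: "v \<in> N_set D x A \<longleftrightarrow> A_of v = A" if "v \<in> V2" "A \<subseteq> {1, 2, 3}" for v A
  proof -
    have "v \<in> N_set D x A \<longleftrightarrow>
        (\<forall>i\<in>A. (x i, v) \<in> parcs D) \<and> (\<forall>j\<in>{1, 2, 3} - A. (v, x j) \<in> parcs D)"
      using that(1) by (simp add: N_set_def verts)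
    also have "\<dots> \<longleftrightarrow> (\<forall>i\<in>A. i \<in> A_of v) \<and> (\<forall>j\<in>{1, 2, 3} - A. j \<notin> A_of v)"
    proof -
      have "(x i, v) \<in> parcs D \<longleftrightarrow> i \<in> A_of v" if "i \<in> A" for i
        using A_of_iff(1)[of i v] that \<open>v \<in> V2\<close> \<open>A \<subseteq> {1, 2, 3}\<close> by (metis UnI1 subsetD)
      moreover have "(v, x j) \<in> parcs D \<longleftrightarrow> j \<notin> A_of v" if "j \<in> {1, 2, 3} - A" for j
        using A_of_iff(2)[of j v] that \<open>v \<in> V2\<close> by (metis UnI1 DiffD1)
      ultimately show ?thesis by (metis (no_types, lifting))
    qed
    also have "\<dots> \<longleftrightarrow> A_of v = A"
    proof -
      have "A_of v \<subseteq> {1, 2, 3}" unfolding A_of_def by (rule Collect_restrict)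
      then show ?thesis using that(2) by (metis DiffI subsetD subsetI subset_antisym DiffD2)
    qed
    finally show ?thesis .
  qed
  \<comment> \<open>The nonempty classes are the values of \<open>A_of\<close> on \<open>V2\<close>,
    so exactly two types occur.\<close>
  have "{A \<in> Pow {1, 2, 3}. V2 \<inter> N_set D x A \<noteq> {}} = A_of ` V2"
  proof (intro set_eqI iffI)
    fix A assume "A \<in> A_of ` V2"
    then obtain v where v: "v \<in> V2" "A = A_of v" by (rule imageE)
    then have A: "A \<subseteq> {1, 2, 3}" unfolding A_of_def by (simp only: Collect_restrict)
    then have "v \<in> N_set D x A" using N_iff v by simp
    then show "A \<in> {A \<in> Pow {1, 2, 3}. V2 \<inter> N_set D x A \<noteq> {}}" using A v by blast
  next
    fix A assume "A \<in> {A \<in> Pow {1, 2, 3}. V2 \<inter> N_set D x A \<noteq> {}}"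
    then obtain v where "A \<subseteq> {1, 2, 3}" "v \<in> V2" "v \<in> N_set D x A" by blast
    then have "v \<in> V2" "A_of v = A" using N_iff by simp_all
    then show "A \<in> A_of ` V2" by blast
  qed
  then obtain A B where AB: "A_of ` V2 = {A, B}" "A \<noteq> B"
    using assms(15) by (auto simp: card_2_iff)
  have "A \<in> A_of ` V2" "B \<in> A_of ` V2" using AB by auto
  then have "A \<subseteq> {1, 2, 3}" "B \<subseteq> {1, 2, 3}"
    unfolding A_of_def by (elim imageE; simp only: Collect_restrict)+
  then have "q < (p + 1) choose ((p + 1) div 2)"
    using card_lt_central[OF AB] assms(1,6,8) by simp
  then show ?thesis by linarith
qed

end
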